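(* Let $X$ be a real Banach space with $\dim X\ge 3$. Suppose that $X$ contains a closed subspace of codimension $1$ which is the range of a linear projection $P:X\to X$ with $\|P\|=1$, and suppose that the group of surjective linear isometries of $X$ is almost transitive. Then $X$ is isometric to a Hilbert space.
   Context: The group of surjective linear isometries of $X$ is called almost transitive if for every $x$ in the unit sphere $S_X=\{x\in X:\|x\|=1\}$, the orbit $G_x=\{Tx: T:X\to X \text{ a surjective linear isometry}\}$ is dense in $S_X$. *)

theory Defs
  imports "HOL-Analysis.Analysis"
begin

definition surj_lin_isometry :: "('a::real_normed_vector \<Rightarrow> 'a) \<Rightarrow> bool" where
  "surj_lin_isometry T \<longleftrightarrow> linear T \<and> surj T \<and> (\<forall>x. norm (T x) = norm x)"

definition almost_transitive :: "'a::real_normed_vector itself \<Rightarrow> bool" where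
  "almost_transitive _ \<longleftrightarrow>
     (\<forall>x::'a. norm x = 1 \<longrightarrow>
        sphere 0 1 \<subseteq> closure {T x | T. surj_lin_isometry T})"

definition codim_one :: "'a::real_vector set \<Rightarrow> bool" where
  "codim_one Y \<longleftrightarrow> subspace Y \<and> (\<exists>v. v \<notin> Y \<and> (\<forall>x. \<exists>c. x - c *\<^sub>R v \<in> Y))"

text \<open>The space has (linear) dimension at least n: it contains n linearly independent vectors
  (meaningful also for infinite-dimensional spaces).\<close>
definition dim_at_least :: "'a::real_vector itself \<Rightarrow> nat \<Rightarrow> bool" where
  "dim_at_least _ n \<longleftrightarrow> (\<exists>S::'a set. finite S \<and> card S = n \<and> independent S)"

text \<open>The norm of X comes from an inner product, i.e. X (being complete) is isometric
  (via the identity) to a Hilbert space.\<close>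
definition hilbertian :: "'a::real_normed_vector itself \<Rightarrow> bool" where
  "hilbertian _ \<longleftrightarrow> (\<exists>ip :: 'a \<Rightarrow> 'a \<Rightarrow> real.
      (\<forall>x y. ip x y = ip y x) \<and>
      (\<forall>y. linear (\<lambda>x. ip x y)) \<and>
      (\<forall>x. ip x x \<ge> 0) \<and>
      (\<forall>x. norm x = sqrt (ip x x)))"

end

theory Submission
  imports Defs
begin

text \<open>
  Write the given projection as \<open>x - f(x)e\<close>. Almost transitivity moves \<open>e\<close> close to any
  unit vector, so on a three-dimensional subspace, with norm \<open>N\<close>, a compactness argument produces
  for \<^emph>\<open>every\<close> line a projection of norm one with that line as its kernel.

  Let \<open>g\<close> expose the unit ball at \<open>x\<close>. The projections along the lines of the plane
  \<open>ker g\<close> all fix \<open>x\<close>. Composing many of them, along directions that make a half turn in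
  \<open>ker g\<close>, carries \<open>m\<close> to \<open>-m\<close> with an arbitrarily small loss of norm, and it follows that
  \<open>v - 2g(v)x\<close> is an isometry. Exposing functionals are dense, so every nonzero functional \<open>u\<close>
  has such a reflection \<open>v - 2u(v)x\<close>; equivalently, the dual norm admits a reflection in
  every direction.

  A norm with reflections in all directions is strictly convex. Hence the reflection along
  \<open>x - y\<close> swaps the unit vectors \<open>x\<close> and \<open>y\<close>, and conjugating by it shows that the functionals
  of the reflections fit together to a symmetric bilinear form, which is the inner product.
\<close>

section \<open>Norms with reflections in all directions\<close>

locale vector_norm =
  fixes N :: "'v::real_vector \<Rightarrow> real"
  assumes triangle: "N (x + y) \<le> N x + N y"
    and scale: "N (c *\<^sub>R x) = \<bar>c\<bar> * N x"
    and pos: "x \<noteq> 0 \<Longrightarrow> N x > 0"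
begin

lemma zero [simp]: "N 0 = 0"
  using scale[of 0 0] by simp

lemma nonneg [simp]: "N x \<ge> 0"
  using pos[of x] by (cases "x = 0") auto

lemma minus [simp]: "N (- x) = N x"
  using scale[of "-1" x] by simp

lemma triangle_diff: "N (x - y) \<le> N x + N y"
  using triangle[of x "- y"] by simp

lemma normalize: "x \<noteq> 0 \<Longrightarrow> N (x /\<^sub>R N x) = 1"
  using pos[of x] by (simp add: scale)

lemma bounded_multiples_imp_zero:
  assumes "\<And>k::nat. N (h + (of_nat k * c) *\<^sub>R u) \<le> C" and "u \<noteq> 0"
  shows "c = 0"
proof (rule ccontr)
  assume "c \<noteq> 0"
  then have p: "\<bar>c\<bar> * N u > 0" using pos[OF assms(2)] by simp
  obtain k :: nat where k: "of_nat k * (\<bar>c\<bar> * N u) > C + N h"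
    using reals_Archimedean3[OF p] by blast
  have "of_nat k * (\<bar>c\<bar> * N u) = N ((h + (of_nat k * c) *\<^sub>R u) - h)"
    by (simp add: scale abs_mult)
  also have "\<dots> \<le> C + N h"
    using triangle_diff[of "h + (of_nat k * c) *\<^sub>R u" h] assms(1)[of k] by linarith
  finally show False using k by simp
qed

text \<open>The map in question is then a linear involution that fixes the kernel of
  \<open>\<phi>\<close> pointwise and negates \<open>u\<close>.\<close>

definition reflecting :: "'v \<Rightarrow> ('v \<Rightarrow> real) \<Rightarrow> bool" where
  "reflecting u \<phi> \<longleftrightarrow> linear \<phi> \<and> \<phi> u = 1 \<and> (\<forall>h. N (h - (2 * \<phi> h) *\<^sub>R u) = N h)"

lemma reflecting_nonzero: "reflecting u \<phi> \<Longrightarrow> u \<noteq> 0"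
  unfolding reflecting_def by (metis linear_0 zero_neq_one)

text \<open>The product of the two reflections is the shear that adds
  \<open>2 * (\<psi> h - \<phi> h)\<close> times \<open>u\<close> to \<open>h\<close>. As
  \<open>\<psi> - \<phi>\<close> kills \<open>u\<close>, this coefficient does not change under the
  shear, so the iterates of an isometry would be unbounded unless it vanishes.\<close>

lemma reflecting_unique:
  assumes "reflecting u \<phi>" and "reflecting u \<psi>"
  shows "\<phi> = \<psi>"
proof
  fix h
  have lin: "linear \<phi>" "linear \<psi>" and one: "\<phi> u = 1" "\<psi> u = 1"
    using assms by (auto simp: reflecting_def)
  let ?c = "2 * (\<psi> h - \<phi> h)"
  have "N (h + (of_nat k * ?c) *\<^sub>R u) = N h" for k :: nat
  proof (induction k)
    case (Suc k)
    define v where "v = h + (of_nat k * ?c) *\<^sub>R u"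
    define v' where "v' = v - (2 * \<psi> v) *\<^sub>R u"
    have v: "\<phi> v = \<phi> h + of_nat k * ?c" "\<psi> v = \<psi> h + of_nat k * ?c"
      using lin one by (simp_all add: v_def linear_add linear_scale)
    have "\<phi> v' = \<phi> v - 2 * \<psi> v"
      using lin one by (simp add: v'_def linear_diff linear_scale)
    then have "v' - (2 * \<phi> v') *\<^sub>R u = v + (2 * (\<psi> v - \<phi> v)) *\<^sub>R u"
      by (simp add: v'_def algebra_simps flip: scaleR_add_left scaleR_diff_left)
    also have "\<dots> = h + (of_nat (Suc k) * ?c) *\<^sub>R u"
      by (simp add: v) (simp add: v_def algebra_simps)
    finally have eq: "v' - (2 * \<phi> v') *\<^sub>R u = h + (of_nat (Suc k) * ?c) *\<^sub>R u" .
    have "N (v' - (2 * \<phi> v') *\<^sub>R u) = N v" 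
      using assms unfolding reflecting_def v'_def by metis
    then show ?case unfolding eq using Suc by (simp add: v_def)
  qed simp
  then have "?c = 0"
    using bounded_multiples_imp_zero[of h ?c u "N h"] reflecting_nonzero[OF assms(1)]
    by (metis order_refl)
  then show "\<phi> h = \<psi> h" by simp
qed

lemma reflecting_scale:
  assumes "reflecting u \<phi>" and "c \<noteq> 0"
  shows "reflecting (c *\<^sub>R u) (\<lambda>h. \<phi> h / c)"
proof -
  have "linear \<phi>" "\<phi> u = 1" using assms by (auto simp: reflecting_def)
  then have "linear (\<lambda>h. \<phi> h / c)" "\<phi> (c *\<^sub>R u) / c = 1"
    using assms(2) by (auto simp: linear_iff add_divide_distrib linear_scale)
  then show ?thesis using assms by (auto simp: reflecting_def)
qed

end

section \<open>Strict convexity and the inner product of a norm with all reflections\<close>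

locale reflective_norm = vector_norm N for N :: "'v::real_vector \<Rightarrow> real" +
  assumes ex_reflecting: "u \<noteq> 0 \<Longrightarrow> \<exists>\<phi>. reflecting u \<phi>"
begin

text \<open>If the norm is constant near \<open>p\<close> on a line, the reflection in \<open>p\<close> maps that line to its
  mirror image in the origin; hence the line is symmetric about \<^emph>\<open>each\<close> point of the segment, which
  makes the norm periodic along the line.\<close>

lemma flat_symmetric:
  assumes e: "e > 0" and flat: "\<And>s. \<bar>s\<bar> < e \<Longrightarrow> N (p + s *\<^sub>R z) = 1"
  shows "N (p + s *\<^sub>R z) = N (p - s *\<^sub>R z)"
proof -
  have Np: "N p = 1" using flat[of 0] e by simp
  then have "p \<noteq> 0" by auto
  then obtain \<phi> where "reflecting p \<phi>" using ex_reflecting by blast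
  then have lin: "linear \<phi>" and one: "\<phi> p = 1" and iso: "\<And>h. N (h - (2 * \<phi> h) *\<^sub>R p) = N h"
    by (auto simp: reflecting_def)
  define c where "c = \<phi> z"
  have refl: "N (p + s *\<^sub>R z) = N ((1 + 2 * s * c) *\<^sub>R p - s *\<^sub>R z)" for s
  proof -
    have "\<phi> (p + s *\<^sub>R z) = 1 + s * c"
      using lin one by (simp add: linear_add linear_scale c_def)
    then have "p + s *\<^sub>R z - (2 * \<phi> (p + s *\<^sub>R z)) *\<^sub>R p = - ((1 + 2 * s * c) *\<^sub>R p - s *\<^sub>R z)"
      by (simp add: algebra_simps flip: scaleR_2)
    then show ?thesis using iso[of "p + s *\<^sub>R z"] by (metis minus)
  qed
  have "c = 0"
  proof (rule ccontr)
    assume "c \<noteq> 0"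
    \<comment> \<open>This choice keeps \<open>b\<close> at least 1/2 and \<open>s / b\<close> below
      \<open>e\<close>, so that flatness evaluates both sides of \<open>refl\<close>: one is 1, the
      other is \<open>b\<close>.\<close>
    define s where "s = min (e / 4) (1 / (4 * \<bar>c\<bar>))"
    have s: "s > 0" "s < e / 2" "s * \<bar>c\<bar> \<le> 1 / 4"
      using e \<open>c \<noteq> 0\<close> by (auto simp: s_def min_def field_simps)
    define b where "b = 1 + 2 * s * c"
    have sc: "\<bar>s * c\<bar> \<le> 1/4" using s by (simp add: abs_mult)
    then have b: "b \<ge> 1 / 2" unfolding b_def by linarith
    have "s / b \<le> s / (1/2)" using s b by (intro divide_left_mono) auto
    then have "\<bar>- (s / b)\<bar> < e" using s b by simp
    then have "N (p + (- (s / b)) *\<^sub>R z) = 1" by (rule flat)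
    then have "N (b *\<^sub>R (p + (- (s / b)) *\<^sub>R z)) = b" using b by (simp add: scale)
    moreover have "b *\<^sub>R (p + (- (s / b)) *\<^sub>R z) = b *\<^sub>R p - s *\<^sub>R z"
      using b by (simp add: algebra_simps)
    ultimately have "N (p + s *\<^sub>R z) = b" using refl[of s] by (simp add: b_def)
    moreover have "N (p + s *\<^sub>R z) = 1" using s by (intro flat) auto
    ultimately show False using s \<open>c \<noteq> 0\<close> by (simp add: b_def)
  qed
  then show ?thesis using refl[of s] by simp
qed

lemma no_flat:
  assumes e: "e > 0" and flat: "\<And>s. \<bar>s\<bar> < e \<Longrightarrow> N (p + s *\<^sub>R z) = 1"
  shows "z = 0"
proof (rule ccontr)
  assume z: "z \<noteq> 0"
  define d where "d = e / 2"
  have d: "d > 0" using e by (simp add: d_def)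
  have flat': "N ((p + d *\<^sub>R z) + s *\<^sub>R z) = 1" if "\<bar>s\<bar> < d" for s
    using flat[of "d + s"] that by (simp add: d_def algebra_simps)
  \<comment> \<open>The symmetries about \<open>p\<close> and about \<open>p + d *\<^sub>R z\<close>
    compose to a translation of the line by twice \<open>d\<close>.\<close>
  have period: "N (p + (s + d + d) *\<^sub>R z) = N (p + s *\<^sub>R z)" for s
  proof -
    have "N (p + (s + d + d) *\<^sub>R z) = N ((p + d *\<^sub>R z) + (s + d) *\<^sub>R z)"
      by (simp only: scaleR_add_left add_ac)
    also have "\<dots> = N ((p + d *\<^sub>R z) - (s + d) *\<^sub>R z)"
      by (rule flat_symmetric[OF d flat'])
    also have "\<dots> = N (p - s *\<^sub>R z)" by (simp add: algebra_simps)
    also have "\<dots> = N (p + s *\<^sub>R z)" by (rule flat_symmetric[OF e flat, symmetric])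
    finally show ?thesis .
  qed
  have "N (p + (of_nat k * (2 * d)) *\<^sub>R z) = N p" for k :: nat
  proof (induction k)
    case (Suc k)
    moreover have "of_nat (Suc k) * (2 * d) = of_nat k * (2 * d) + d + d"
      by (simp add: algebra_simps)
    ultimately show ?case using period[of "of_nat k * (2 * d)"] by metis
  qed simp
  then have "2 * d = 0" using bounded_multiples_imp_zero[of p "2 * d" z "N p"] z
    by (metis order_refl)
  then show False using d by simp
qed

text \<open>An interior point \<open>p\<close> of norm one makes the chord flat near it, because
  \<open>p\<close> is the midpoint of \<open>p + s *\<^sub>R z\<close> and
  \<open>p - s *\<^sub>R z\<close>, both of norm at most one. Flat pieces are excluded by
  \<open>no_flat\<close>.\<close>

lemma strictly_convex:
  assumes N: "N a = 1" "N b = 1" and t: "0 < t" "t < 1"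
    and Nt: "N ((1 - t) *\<^sub>R a + t *\<^sub>R b) = 1"
  shows "a = b"
proof -
  define p where "p = (1 - t) *\<^sub>R a + t *\<^sub>R b"
  define z where "z = b - a"
  have chord: "N (a + r *\<^sub>R z) \<le> 1" if "0 \<le> r" "r \<le> 1" for r
  proof -
    have "a + r *\<^sub>R z = (1 - r) *\<^sub>R a + r *\<^sub>R b" by (simp add: z_def algebra_simps)
    then show ?thesis
      using triangle[of "(1 - r) *\<^sub>R a" "r *\<^sub>R b"] that N by (simp add: scale)
  qed
  have p: "p = a + t *\<^sub>R z" by (simp add: p_def z_def algebra_simps)
  define e where "e = min t (1 - t)"
  have e: "e > 0" using t by (simp add: e_def)
  have le: "N (p + s *\<^sub>R z) \<le> 1" if "\<bar>s\<bar> < e" for s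
  proof -
    have "0 \<le> t + s" "t + s \<le> 1" using that by (auto simp: e_def)
    then show ?thesis using chord[of "t + s"] by (simp add: p algebra_simps)
  qed
  have "N (p + s *\<^sub>R z) = 1" if s: "\<bar>s\<bar> < e" for s
  proof -
    have "2 *\<^sub>R p = (p + s *\<^sub>R z) + (p + (- s) *\<^sub>R z)" by (simp add: scaleR_2)
    then have "2 * N p \<le> N (p + s *\<^sub>R z) + N (p + (- s) *\<^sub>R z)"
      by (metis triangle scale abs_numeral)
    moreover have "N p = 1" using Nt by (simp add: p_def)
    ultimately show ?thesis using le[of s] le[of "- s"] s by simp
  qed
  then have "z = 0" by (rule no_flat[OF e])
  then show ?thesis by (simp add: z_def)
qed

lemma no_three_on_line:
  assumes "z \<noteq> 0" and "N (a + r *\<^sub>R z) = 1" "N (a + s *\<^sub>R z) = 1" "N (a + t *\<^sub>R z) = 1"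
    and "r < s" "s < t"
  shows False
proof -
  define q where "q = (s - r) / (t - r)"
  have q: "0 < q" "q < 1" "q * (t - r) = s - r"
    using assms(5,6) by (simp_all add: q_def)
  have "(1 - q) *\<^sub>R (a + r *\<^sub>R z) + q *\<^sub>R (a + t *\<^sub>R z) = a + (r + q * (t - r)) *\<^sub>R z"
    by (simp add: algebra_simps)
  also have "\<dots> = a + s *\<^sub>R z" using q(3) by simp
  finally have "a + r *\<^sub>R z = a + t *\<^sub>R z"
    using strictly_convex[OF assms(2,4) q(1,2)] assms(3) by simp
  then show False using assms by simp
qed

text \<open>The reflection along \<open>x - y\<close> maps the chord through \<open>x\<close> and \<open>y\<close> to itself, and by strict
  convexity it has to swap its two end points.\<close>

lemma swap_reflection:
  assumes N: "N x = 1" "N y = 1" and ne: "x \<noteq> y" and refl: "reflecting (x - y) \<phi>"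
  shows "y - (2 * \<phi> y) *\<^sub>R (x - y) = x" and "x - (2 * \<phi> x) *\<^sub>R (x - y) = y"
proof -
  define z where "z = x - y"
  have z: "z \<noteq> 0" using ne by (simp add: z_def)
  have lin: "linear \<phi>" and one: "\<phi> z = 1" and iso: "\<And>h. N (h - (2 * \<phi> h) *\<^sub>R z) = N h"
    using refl by (auto simp: reflecting_def z_def)
  \<comment> \<open>On the line with \<open>y\<close> at parameter 0 and \<open>x\<close> at 1, the
    reflection sends \<open>y\<close> to \<open>\<tau>\<close> and \<open>x\<close> to
    \<open>\<tau> - 1\<close>.\<close>
  define \<tau> where "\<tau> = - 2 * \<phi> y"
  have \<phi>x: "\<phi> x = \<phi> y + 1" using lin one by (simp add: z_def linear_diff)
  have 0: "N (y + 0 *\<^sub>R z) = 1" and 1: "N (y + 1 *\<^sub>R z) = 1" using N by (simp_all add: z_def)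
  have "y - (2 * \<phi> y) *\<^sub>R z = y + \<tau> *\<^sub>R z" by (simp add: \<tau>_def)
  then have t: "N (y + \<tau> *\<^sub>R z) = 1" using iso[of y] N by metis
  have "x - (2 * \<phi> x) *\<^sub>R z = y + z - (2 * \<phi> y + 2) *\<^sub>R z" by (simp add: \<phi>x z_def)
  also have "\<dots> = y + (\<tau> - 1) *\<^sub>R z" by (simp add: \<tau>_def algebra_simps flip: scaleR_2)
  finally have eq: "x - (2 * \<phi> x) *\<^sub>R z = y + (\<tau> - 1) *\<^sub>R z" .
  then have t1: "N (y + (\<tau> - 1) *\<^sub>R z) = 1" using iso[of x] N by simp
  \<comment> \<open>Otherwise 0, 1 and \<open>\<tau>\<close> are three parameters of points on the
    unit sphere; if \<open>\<tau>\<close> is 0, then -1, 0 and 1 are.\<close>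
  have "\<tau> = 1"
  proof (rule ccontr)
    assume "\<tau> \<noteq> 1"
    then consider "\<tau> < 0" | "\<tau> = 0" | "0 < \<tau>" "\<tau> < 1" | "1 < \<tau>" by linarith
    then show False
    proof cases
      case 1
      then show False using no_three_on_line[OF z t 0 \<open>N (y + 1 *\<^sub>R z) = 1\<close>] by simp
    next
      case 2
      then show False using no_three_on_line[OF z t1 0 1] by simp
    next
      case 3
      then show False using no_three_on_line[OF z 0 t 1] by simp
    next
      case 4
      then show False using no_three_on_line[OF z 0 1 t] by simp
    qed
  qed
  then show "y - (2 * \<phi> y) *\<^sub>R (x - y) = x" "x - (2 * \<phi> x) *\<^sub>R (x - y) = y"
    using eq by (simp_all add: \<tau>_def z_def)
qed

text \<open>Conjugation by the isometry \<open>T\<close> that swaps \<open>x\<close> and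
  \<open>y\<close> turns the reflection at \<open>x\<close> into one at \<open>y\<close> with
  functional \<open>\<phi> \<circ> T\<close>. By uniqueness this is \<open>\<psi>\<close>.\<close>

lemma reflecting_symmetric_unit:
  assumes N: "N x = 1" "N y = 1" and rx: "reflecting x \<phi>" and ry: "reflecting y \<psi>"
  shows "\<phi> y = \<psi> x"
proof (cases "x = y")
  case True
  then show ?thesis using reflecting_unique[of x \<phi> \<psi>] assms by simp
next
  case False
  then obtain \<xi> where \<xi>: "reflecting (x - y) \<xi>" using ex_reflecting[of "x - y"] by auto
  define T where "T h = h - (2 * \<xi> h) *\<^sub>R (x - y)" for h
  have lin: "linear \<xi>" "\<xi> (x - y) = 1" and iso: "\<And>h. N (T h) = N h"
    using \<xi> by (auto simp: reflecting_def T_def)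
  have swap: "T y = x" "T x = y"
    using swap_reflection[OF N False \<xi>] by (simp_all add: T_def)
  have linT: "linear T"
    by (rule linearI) (simp_all add: T_def lin linear_add linear_scale algebra_simps)
  have "\<xi> (T h) = - \<xi> h" for h
    using lin by (simp add: T_def linear_diff[OF lin(1)] linear_scale[OF lin(1)])
  then have TT: "T (T h) = h" for h
    by (simp add: T_def[of "T h"]) (simp add: T_def)
  have \<phi>: "linear \<phi>" "\<phi> x = 1" "\<And>h. N (h - (2 * \<phi> h) *\<^sub>R x) = N h"
    using rx by (auto simp: reflecting_def)
  have "N (h - (2 * \<phi> (T h)) *\<^sub>R y) = N h" for h
  proof -
    have "T (T h - (2 * \<phi> (T h)) *\<^sub>R x) = h - (2 * \<phi> (T h)) *\<^sub>R y"
      using linT by (simp add: linear_diff linear_scale TT swap)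
    then show ?thesis by (metis iso \<phi>(3))
  qed
  then have "reflecting y (\<phi> \<circ> T)"
    using \<phi> linT swap by (auto simp: reflecting_def linear_compose)
  then have "\<psi> = \<phi> \<circ> T" using reflecting_unique[OF ry] by simp
  then show ?thesis using swap by simp
qed

text \<open>Normalising \<open>u\<close> multiplies its functional by \<open>N u\<close>, and
  likewise for \<open>v\<close>; the squares appear when denominators are cleared.\<close>

lemma reflecting_symmetric:
  assumes ru: "reflecting u \<phi>" and rv: "reflecting v \<psi>"
  shows "(N u)\<^sup>2 * \<phi> v = (N v)\<^sup>2 * \<psi> u"
proof -
  have nz: "N u > 0" "N v > 0"
    using reflecting_nonzero[OF ru] reflecting_nonzero[OF rv] pos by auto
  have lin: "linear \<phi>" "linear \<psi>" using ru rv by (auto simp: reflecting_def)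
  have "reflecting (u /\<^sub>R N u) (\<lambda>h. \<phi> h / inverse (N u))"
       "reflecting (v /\<^sub>R N v) (\<lambda>h. \<psi> h / inverse (N v))"
    using nz by (auto intro!: reflecting_scale ru rv)
  from reflecting_symmetric_unit[OF normalize normalize this]
  have "\<phi> (v /\<^sub>R N v) * N u = \<psi> (u /\<^sub>R N u) * N v"
    using reflecting_nonzero[OF ru] reflecting_nonzero[OF rv] by (simp add: divide_inverse)
  then have "\<phi> v * N u / N v = \<psi> u * N v / N u"
    using lin by (simp add: linear_scale divide_inverse mult_ac)
  then show ?thesis using nz by (simp add: field_simps power2_eq_square)
qed

text \<open>In a Hilbert space the reflection along \<open>u\<close> has as its functional the inner
  product with \<open>u\<close> divided by the squared norm of \<open>u\<close>; this dictates the
  choice of \<open>B\<close>. The last conclusion keeps that link available for the return from the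
  dual norm.\<close>

theorem ex_inner_product:
  obtains B where "\<And>x y. B x y = B y x" and "\<And>y. linear (\<lambda>x. B x y)"
    and "\<And>x. B x x = (N x)\<^sup>2" and "\<And>u \<phi> h. reflecting u \<phi> \<Longrightarrow> B h u = (N u)\<^sup>2 * \<phi> h"
proof -
  obtain \<Phi> where \<Phi>: "\<And>u. u \<noteq> 0 \<Longrightarrow> reflecting u (\<Phi> u)"
    using ex_reflecting by metis
  define B where "B h u = (N u)\<^sup>2 * \<Phi> u h" for h u
  \<comment> \<open>\<open>\<Phi> 0\<close> is unspecified, but the factor \<open>N 0\<close> makes
    \<open>B h 0\<close> vanish.\<close>
  have B0: "B h 0 = 0" "B 0 h = 0" for h
  proof -
    show "B h 0 = 0" by (simp add: B_def)
    show "B 0 h = 0"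
      using \<Phi>[of h] by (cases "h = 0") (auto simp: B_def reflecting_def linear_0)
  qed
  have sym: "B x y = B y x" for x y
    using reflecting_symmetric[OF \<Phi> \<Phi>, of x y] B0
    by (cases "x = 0"; cases "y = 0") (auto simp: B_def)
  have lin: "linear (\<lambda>x. B x y)" for y
  proof (cases "y = 0")
    case True
    then show ?thesis by (simp add: B0 linear_zero)
  next
    case False
    then have "linear (\<Phi> y)" using \<Phi> by (auto simp: reflecting_def)
    then show ?thesis unfolding B_def by (simp add: linear_iff algebra_simps)
  qed
  have sq: "B x x = (N x)\<^sup>2" for x
    using \<Phi>[of x] by (cases "x = 0") (auto simp: B_def reflecting_def)
  have "B h u = (N u)\<^sup>2 * \<phi> h" if "reflecting u \<phi>" for u \<phi> h
    using reflecting_unique[OF that \<Phi>] reflecting_nonzero[OF that] by (simp add: B_def)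
  then show ?thesis using that sym lin sq by blast
qed

end

section \<open>Reflections at exposed points\<close>

unbundle cross3_syntax

locale projective_norm = vector_norm N for N :: "real^3 \<Rightarrow> real" +
  assumes continuous: "continuous_on UNIV N"
    and ex_projection: "w \<noteq> 0 \<Longrightarrow> \<exists>f. f \<bullet> w = 1 \<and> (\<forall>v. N (v - (f \<bullet> v) *\<^sub>R w) \<le> N v)"
begin

text \<open>The minimum of \<open>N\<close> on the Euclidean sphere is positive and so bounds the
  ball in the Euclidean norm.\<close>

lemma compact_ball: "compact {v. N v \<le> 1}"
proof -
  have "\<exists>b\<in>sphere (0::real^3) 1. \<forall>v\<in>sphere 0 1. N b \<le> N v"
    using continuous_attains_inf[of "sphere (0::real^3) 1" N] continuous_on_subset[OF continuous]
    by simp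
  then obtain b where b: "norm b = 1" and min: "\<And>v. norm v = 1 \<Longrightarrow> N b \<le> N v"
    by auto
  have "b \<noteq> 0" using b by auto
  then have Nb: "N b > 0" by (rule pos)
  have "norm v \<le> 1 / N b" if v: "N v \<le> 1" for v
  proof (cases "v = 0")
    case False
    then have "N b \<le> N (v /\<^sub>R norm v)" by (intro min) simp
    then have "N b * norm v \<le> N v" using False by (simp add: scale field_simps)
    then show ?thesis using v Nb by (simp add: field_simps)
  qed (use Nb in simp)
  then have "bounded {v. N v \<le> 1}" by (auto intro!: boundedI)
  moreover have "closed {v. N v \<le> 1}"
    by (intro closed_Collect_le continuous continuous_on_const)
  ultimately show ?thesis by (simp add: compact_eq_bounded_closed)
qed

end

section \<open>Projections along the directions of the plane \<open>ker g\<close>\<close>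

locale exposed_point = projective_norm +
  fixes x g :: "real^3"
  assumes gx: "g \<bullet> x = 1" and g_le: "g \<bullet> v \<le> N v"
    and exposed: "N v \<le> 1 \<Longrightarrow> g \<bullet> v = 1 \<Longrightarrow> v = x"
    and Nx: "N x = 1"
begin

text \<open>This is the determinant of \<open>g\<close>, \<open>u\<close> and \<open>v\<close>; on
  the plane \<open>ker g\<close> it is an oriented area form, up to a constant factor.\<close>

definition area :: "real^3 \<Rightarrow> real^3 \<Rightarrow> real" where
  "area u v = g \<bullet> (u \<times> v)"

lemma area_simps:
  "area (u + u') v = area u v + area u' v" "area (u - u') v = area u v - area u' v"
  "area (c *\<^sub>R u) v = c * area u v" "area (- u) v = - area u v"
  "area u (v + v') = area u v + area u v'" "area u (v - v') = area u v - area u v'"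
  "area u (c *\<^sub>R v) = c * area u v" "area u (- v) = - area u v" "area u u = 0"
  by (simp_all add: area_def cross_add_left cross_add_right cross_mult_left cross_mult_right
      cross_minus_left cross_minus_right Cross3.left_diff_distrib Cross3.right_diff_distrib inner_diff_right
      inner_add_right)

lemma area_swap: "area u v = - area v u"
  unfolding area_def by (subst cross_skew) (simp only: inner_minus_right)

text \<open>The projection along \<open>w\<close> fixes \<open>x\<close>, because \<open>x\<close> is exposed by \<open>g\<close>, and maps the plane
  \<open>ker g\<close> onto the line spanned by the pole \<open>m\<close>.\<close>

definition pole :: "real^3 \<Rightarrow> real^3 \<Rightarrow> bool" where
  "pole w m \<longleftrightarrow> g \<bullet> m = 0 \<and> N m = 1 \<and> area w m > 0 \<and>
     (\<forall>s v. g \<bullet> v = 0 \<longrightarrow> N (s *\<^sub>R x + (area w v / area w m) *\<^sub>R m) \<le> N (s *\<^sub>R x + v))"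

lemma pole_minus: "pole w m \<Longrightarrow> pole (- w) (- m)"
  by (auto simp: pole_def area_simps)

text \<open>The image of \<open>ker g\<close> is the intersection of \<open>ker f\<close> and
  \<open>ker g\<close>, spanned by \<open>g \<times> f\<close>. By Lagrange's identity that vector
  has area \<open>g \<bullet> g\<close> with \<open>w\<close>, which gives the positive
  orientation.\<close>

lemma ex_pole:
  assumes w: "w \<noteq> 0" "g \<bullet> w = 0"
  shows "\<exists>m. pole w m"
proof -
  obtain f where fw: "f \<bullet> w = 1" and f: "\<And>v. N (v - (f \<bullet> v) *\<^sub>R w) \<le> N v"
    using ex_projection[OF w(1)] by blast
  \<comment> \<open>The projection does not change the value of \<open>g\<close> and does not
    increase the norm, so the image of \<open>x\<close> is again the exposed point.\<close>
  have "x - (f \<bullet> x) *\<^sub>R w = x"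
    using f[of x] Nx gx w by (intro exposed) (simp_all add: inner_diff_right)
  then have fx: "f \<bullet> x = 0" using w by simp
  define p where "p = g \<times> f"
  have gg: "g \<bullet> g > 0" using gx by (metis inner_gt_zero_iff inner_zero_left zero_neq_one)
  have wp: "area w p = g \<bullet> g"
    using fw w by (simp add: area_def p_def Lagrange inner_commute)
  then have p0: "p \<noteq> 0" using gg by (auto simp: area_def)
  define m where "m = p /\<^sub>R N p"
  have m: "g \<bullet> m = 0" "f \<bullet> m = 0" "N m = 1"
    using normalize[OF p0] by (simp_all add: m_def p_def dot_cross_self)
  have am: "area w m > 0" using wp gg pos[OF p0] by (simp add: m_def area_simps)
  have "N (s *\<^sub>R x + (area w v / area w m) *\<^sub>R m) \<le> N (s *\<^sub>R x + v)" if v: "g \<bullet> v = 0" for s v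
  proof -
    \<comment> \<open>\<open>v\<close> and its projection \<open>v'\<close> have the same area with
      \<open>w\<close>, and this determines \<open>v'\<close> as a multiple of
      \<open>m\<close>.\<close>
    define v' where "v' = v - (f \<bullet> v) *\<^sub>R w"
    have "g \<bullet> v' = 0" "f \<bullet> v' = 0"
      using v w fw by (simp_all add: v'_def inner_diff_right)
    then have "v' \<times> p = 0" by (simp add: p_def Lagrange inner_commute)
    then have "collinear {0, p, v'}" by (metis cross_eq_0 cross_skew neg_0_equal_iff_equal)
    then obtain c where c: "v' = c *\<^sub>R p" using p0 by (auto simp: collinear_lemma)
    then have c': "v' = (c * N p) *\<^sub>R m" using pos[OF p0] by (simp add: m_def)
    have "area w v = area w v'" by (simp add: v'_def area_simps)
    then have "area w v / area w m = c * N p" using am by (simp add: c' area_simps)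
    then have "s *\<^sub>R x + (area w v / area w m) *\<^sub>R m = s *\<^sub>R x + v'" by (simp add: c')
    also have "\<dots> = (s *\<^sub>R x + v) - (f \<bullet> (s *\<^sub>R x + v)) *\<^sub>R w"
      by (simp add: v'_def inner_add_right fx)
    finally show ?thesis using f by metis
  qed
  then show ?thesis using m am unfolding pole_def by blast
qed

text \<open>The case \<open>s = 0\<close> of the contraction: on the unit ball of
  \<open>ker g\<close>, the area with \<open>w\<close> is largest at the pole.\<close>

lemma area_le_pole:
  assumes "pole w m" and "g \<bullet> v = 0"
  shows "area w v \<le> area w m * N v"
proof -
  have "N (0 *\<^sub>R x + (area w v / area w m) *\<^sub>R m) \<le> N (0 *\<^sub>R x + v)"
    using assms unfolding pole_def by blast
  then have "\<bar>area w v / area w m\<bar> \<le> N v" using assms by (simp add: scale pole_def)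
  then have "area w v / area w m \<le> N v" by linarith
  then show ?thesis using assms by (simp add: pole_def field_simps)
qed

text \<open>Projecting along the new direction takes \<open>m\<close> to \<open>c\<close> times
  \<open>m'\<close>, so the loss is at most \<open>\<bar>\<rho>\<bar> * (1 - c)\<close>. Each pole
  maximises the area with its own direction, which bounds \<open>1 - c\<close> by a difference of
  areas with \<open>d\<close>, a form that telescopes.\<close>

lemma pole_step:
  assumes p0: "pole w m" and p1: "pole (w + \<delta> *\<^sub>R d) m'"
    and d: "g \<bullet> d = 0" "area w d > 0"
  shows "N (s *\<^sub>R x + \<rho> *\<^sub>R m') \<le>
    N (s *\<^sub>R x + \<rho> *\<^sub>R m) + \<bar>\<rho>\<bar> * (N d / area w d) * (\<delta> * area d m' - \<delta> * area d m)"
proof -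
  define w' where "w' = w + \<delta> *\<^sub>R d"
  define c where "c = area w' m / area w' m'"
  have m: "g \<bullet> m = 0" "N m = 1" "g \<bullet> m' = 0" "N m' = 1" and a: "area w m > 0" "area w' m' > 0"
    using p0 p1 by (auto simp: pole_def w'_def)
  have "area w' m \<le> area w' m'"
    using area_le_pole[OF p1 m(1)] m by (simp add: w'_def)
  then have c1: "c \<le> 1" using a by (simp add: c_def)
  have "area w m' \<le> area w m" using area_le_pole[OF p0 m(3)] m by simp
  then have loss: "(1 - c) * area w' m' \<le> \<delta> * area d m' - \<delta> * area d m"
    using a by (simp add: c_def left_diff_distrib) (simp add: w'_def area_simps)
  \<comment> \<open>\<open>w\<close> and \<open>w'\<close> have the same area with \<open>d\<close>,
    so the denominator \<open>area w' m'\<close> has a lower bound independent of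
    \<open>\<delta>\<close>.\<close>
  have "area w' d \<le> area w' m' * N d"
    using area_le_pole[OF p1 d(1)] by (simp add: w'_def)
  then have "1 \<le> area w' m' * (N d / area w d)"
    using d by (simp add: w'_def area_simps field_simps)
  then have "(1 - c) * 1 \<le> (1 - c) * (area w' m' * (N d / area w d))"
    using c1 by (intro mult_left_mono) auto
  also have "\<dots> = ((1 - c) * area w' m') * (N d / area w d)" by simp
  also have "\<dots> \<le> (\<delta> * area d m' - \<delta> * area d m) * (N d / area w d)"
    using loss d by (intro mult_right_mono) auto
  finally have bound: "1 - c \<le> (\<delta> * area d m' - \<delta> * area d m) * (N d / area w d)" by simp
  have "g \<bullet> (\<rho> *\<^sub>R m) = 0" using m by simp
  then have "N (s *\<^sub>R x + (area w' (\<rho> *\<^sub>R m) / area w' m') *\<^sub>R m') \<le> N (s *\<^sub>R x + \<rho> *\<^sub>R m)"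
    using p1 unfolding pole_def w'_def by blast
  then have step: "N (s *\<^sub>R x + (\<rho> * c) *\<^sub>R m') \<le> N (s *\<^sub>R x + \<rho> *\<^sub>R m)"
    by (simp add: area_simps c_def)
  have "s *\<^sub>R x + \<rho> *\<^sub>R m' = (s *\<^sub>R x + (\<rho> * c) *\<^sub>R m') + (\<rho> * (1 - c)) *\<^sub>R m'"
    by (simp add: algebra_simps)
  then have "N (s *\<^sub>R x + \<rho> *\<^sub>R m') \<le> N (s *\<^sub>R x + (\<rho> * c) *\<^sub>R m') + N ((\<rho> * (1 - c)) *\<^sub>R m')"
    by (metis triangle)
  also have "\<dots> \<le> N (s *\<^sub>R x + \<rho> *\<^sub>R m) + \<bar>\<rho>\<bar> * (1 - c)"
    using step c1 m by (simp add: scale abs_mult)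
  also have "\<dots> \<le> N (s *\<^sub>R x + \<rho> *\<^sub>R m)
      + \<bar>\<rho>\<bar> * ((\<delta> * area d m' - \<delta> * area d m) * (N d / area w d))"
    using bound by (intro add_left_mono mult_left_mono) auto
  finally show ?thesis by (simp add: mult_ac)
qed

text \<open>Subdivide the segment from \<open>w\<close> to \<open>w + d\<close> into \<open>n\<close> pieces and project successively: the
  losses telescope to a quantity of order \<open>1 / n\<close>.\<close>

lemma pole_segment:
  assumes p0: "pole w m" and p1: "pole (w + d) m'"
    and w: "g \<bullet> w = 0" and d: "g \<bullet> d = 0" "area w d > 0"
  shows "N (s *\<^sub>R x + \<rho> *\<^sub>R m') \<le> N (s *\<^sub>R x + \<rho> *\<^sub>R m)"
proof -
  define C where "C = \<bar>\<rho>\<bar> * (N d / area w d) * (area d m' - area d m)"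
  have "N (s *\<^sub>R x + \<rho> *\<^sub>R m') \<le> N (s *\<^sub>R x + \<rho> *\<^sub>R m) + C / real (Suc n)" for n
  proof -
    define \<delta> where "\<delta> = 1 / real (Suc n)"
    define W where "W i = w + (real i * \<delta>) *\<^sub>R d" for i
    have aW: "area (W i) d = area w d" for i by (simp add: W_def area_simps)
    have "\<exists>m. pole (W i) m" for i
    proof (rule ex_pole)
      show "W i \<noteq> 0" using aW[of i] d by (auto simp: area_def)
      show "g \<bullet> W i = 0" using w d by (simp add: W_def inner_add_right)
    qed
    then obtain \<mu>0 where \<mu>0: "\<And>i. pole (W i) (\<mu>0 i)" by metis
    \<comment> \<open>A direction may have several poles; the prescribed ones are imposed at the two
      ends of the subdivision.\<close>
    define \<mu> where "\<mu> i = (if i = 0 then m else if i = Suc n then m' else \<mu>0 i)" for i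
    have W: "W 0 = w" "W (Suc n) = w + d" by (simp_all add: W_def \<delta>_def)
    have \<mu>: "pole (W i) (\<mu> i)" for i using \<mu>0[of i] p0 p1 W by (auto simp: \<mu>_def)
    let ?K = "\<bar>\<rho>\<bar> * (N d / area w d)"
    have "N (s *\<^sub>R x + \<rho> *\<^sub>R \<mu> k) \<le>
        N (s *\<^sub>R x + \<rho> *\<^sub>R m) + ?K * (\<delta> * area d (\<mu> k) - \<delta> * area d m)" for k
    proof (induction k)
      case (Suc k)
      have "W (Suc k) = W k + \<delta> *\<^sub>R d" by (simp add: W_def algebra_simps)
      then have "N (s *\<^sub>R x + \<rho> *\<^sub>R \<mu> (Suc k)) \<le> N (s *\<^sub>R x + \<rho> *\<^sub>R \<mu> k)
          + ?K * (\<delta> * area d (\<mu> (Suc k)) - \<delta> * area d (\<mu> k))"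
        using pole_step[OF \<mu>[of k], of \<delta> d "\<mu> (Suc k)"] \<mu>[of "Suc k"] d aW[of k]
        by (simp add: \<delta>_def)
      with Suc show ?case by (simp add: right_diff_distrib)
    qed (simp add: \<mu>_def)
    from this[of "Suc n"] show ?thesis
      by (simp add: \<mu>_def C_def \<delta>_def right_diff_distrib diff_divide_distrib)
  qed
  moreover have "(\<lambda>n. N (s *\<^sub>R x + \<rho> *\<^sub>R m) + C / real (Suc n))
      \<longlonglongrightarrow> N (s *\<^sub>R x + \<rho> *\<^sub>R m) + 0"
    by (intro tendsto_intros LIMSEQ_Suc lim_const_over_n)
  ultimately show ?thesis
    using LIMSEQ_le_const[of _ "N (s *\<^sub>R x + \<rho> *\<^sub>R m) + 0"] by simp
qed

text \<open>The straight path from \<open>w\<close> to \<open>- w\<close> passes through the origin,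
  so the half turn goes by way of \<open>m\<close>. Both segments turn in the same sense because
  \<open>area w m > 0\<close>, and \<open>- m\<close> is a pole of \<open>- w\<close>.\<close>

lemma pole_half_turn:
  assumes p: "pole w m" and w: "g \<bullet> w = 0"
  shows "N (s *\<^sub>R x - \<rho> *\<^sub>R m) \<le> N (s *\<^sub>R x + \<rho> *\<^sub>R m)"
proof -
  have m: "g \<bullet> m = 0" "area w m > 0" "N m = 1" using p by (auto simp: pole_def)
  then have "m \<noteq> 0" by auto
  then obtain m' where p': "pole m m'" using ex_pole m by blast
  have "N (s *\<^sub>R x + \<rho> *\<^sub>R m') \<le> N (s *\<^sub>R x + \<rho> *\<^sub>R m)"
    by (rule pole_segment[OF p, of "m - w"])
      (use p' m w in \<open>simp_all add: inner_diff_right area_simps\<close>)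
  moreover have "N (s *\<^sub>R x + \<rho> *\<^sub>R (- m)) \<le> N (s *\<^sub>R x + \<rho> *\<^sub>R m')"
    by (rule pole_segment[OF p', of "- w - m"])
      (use pole_minus[OF p] m w area_swap[of m w] in \<open>simp_all add: inner_diff_right area_simps\<close>)
  ultimately show ?thesis by simp
qed

text \<open>If \<open>- k\<close> lay outside the convex sublevel set \<open>K\<close>, a plane with
  normal \<open>a\<close> would separate it from \<open>K\<close>. Projecting along the direction
  common to \<open>ker g\<close> and \<open>ker a\<close> takes \<open>k\<close> to
  \<open>c *\<^sub>R m\<close> with the same value of \<open>a\<close>; the half turn then puts
  \<open>- (c *\<^sub>R m)\<close> into \<open>K\<close>, on the wrong side.\<close>

lemma reflect_le:
  assumes k: "g \<bullet> k = 0"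
  shows "N (s *\<^sub>R x - k) \<le> N (s *\<^sub>R x + k)"
proof (rule ccontr)
  assume neg: "\<not> ?thesis"
  define K where "K = {y. g \<bullet> y = 0 \<and> N (s *\<^sub>R x + y) \<le> N (s *\<^sub>R x + k)}"
  have "continuous_on UNIV (\<lambda>y. N (s *\<^sub>R x + y))"
    by (rule continuous_on_compose2[OF continuous]) (auto intro!: continuous_intros)
  then have "closed K" unfolding K_def
    by (intro closed_Collect_conj closed_Collect_le closed_Collect_eq continuous_intros)
  moreover have "convex K"
  proof (rule convexI)
    fix y z and a b :: real
    assume yz: "y \<in> K" "z \<in> K" and ab: "0 \<le> a" "0 \<le> b" "a + b = 1"
    have "s *\<^sub>R x + (a *\<^sub>R y + b *\<^sub>R z) = (a + b) *\<^sub>R (s *\<^sub>R x) + (a *\<^sub>R y + b *\<^sub>R z)"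
      using ab by simp
    also have "\<dots> = a *\<^sub>R (s *\<^sub>R x + y) + b *\<^sub>R (s *\<^sub>R x + z)"
      by (simp only: scaleR_add_left scaleR_add_right) (simp add: add_ac)
    finally have "N (s *\<^sub>R x + (a *\<^sub>R y + b *\<^sub>R z)) \<le> a * N (s *\<^sub>R x + y) + b * N (s *\<^sub>R x + z)"
      using triangle[of "a *\<^sub>R (s *\<^sub>R x + y)" "b *\<^sub>R (s *\<^sub>R x + z)"] ab by (simp add: scale)
    also have "\<dots> \<le> a * N (s *\<^sub>R x + k) + b * N (s *\<^sub>R x + k)"
      using yz ab by (intro add_mono mult_left_mono) (auto simp: K_def)
    also have "\<dots> = N (s *\<^sub>R x + k)" using ab by (simp flip: distrib_right)
    finally show "a *\<^sub>R y + b *\<^sub>R z \<in> K" using yz by (simp add: K_def inner_add_right)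
  qed
  moreover have "- k \<notin> K" using neg k by (simp add: K_def)
  ultimately obtain a b where ab: "a \<bullet> (- k) < b" and sep: "\<And>y. y \<in> K \<Longrightarrow> a \<bullet> y > b"
    using separating_hyperplane_closed_point[of K "- k"] by blast
  have kK: "k \<in> K" using k by (simp add: K_def)
  have gg: "g \<bullet> g > 0" using gx by (metis inner_gt_zero_iff inner_zero_left zero_neq_one)
  define w where "w = g \<times> a"
  have gw: "g \<bullet> w = 0" by (simp add: w_def dot_cross_self)
  have area: "area w v = - (g \<bullet> g) * (a \<bullet> v)" if "g \<bullet> v = 0" for v
  proof -
    have "v \<times> w = (a \<bullet> v) *\<^sub>R g" using that by (simp add: w_def Lagrange inner_commute)
    then have "area v w = (g \<bullet> g) * (a \<bullet> v)" by (simp add: area_def)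
    then show ?thesis using area_swap[of w v] by simp
  qed
  \<comment> \<open>If \<open>w\<close> were 0, then \<open>a\<close> would vanish on
    \<open>ker g\<close> and could not separate \<open>- k\<close> from \<open>k\<close>.\<close>
  have "w \<noteq> 0"
  proof
    assume "w = 0"
    then have "a \<bullet> k = 0" using area[OF k] gg by (simp add: area_def)
    then show False using ab sep[OF kK] by simp
  qed
  then obtain m where p: "pole w m" using ex_pole gw by blast
  then have m: "g \<bullet> m = 0" "area w m > 0" by (auto simp: pole_def)
  define c where "c = area w k / area w m"
  have am: "a \<bullet> m \<noteq> 0" using m area[OF m(1)] by auto
  then have "c = (a \<bullet> k) / (a \<bullet> m)" using gg by (simp add: c_def area m k)
  then have ac: "a \<bullet> (c *\<^sub>R m) = a \<bullet> k" using am by simp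
  have "N (s *\<^sub>R x - c *\<^sub>R m) \<le> N (s *\<^sub>R x + c *\<^sub>R m)" by (rule pole_half_turn[OF p gw])
  also have "\<dots> \<le> N (s *\<^sub>R x + k)" using p k unfolding pole_def c_def by blast
  finally have "- (c *\<^sub>R m) \<in> K" using m by (simp add: K_def)
  from sep[OF this] ab ac show False by simp
qed

lemma reflection_isometry: "N (v - (2 * (g \<bullet> v)) *\<^sub>R x) = N v"
proof -
  define s where "s = g \<bullet> v"
  define k where "k = v - s *\<^sub>R x"
  have k: "g \<bullet> k = 0" by (simp add: k_def s_def inner_diff_right gx)
  have "N (s *\<^sub>R x - k) = N (s *\<^sub>R x + k)"
    using reflect_le[of k s] reflect_le[of "- k" s] k by simp
  moreover have "v - (2 * (g \<bullet> v)) *\<^sub>R x = - (s *\<^sub>R x - k)"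
    by (simp add: k_def s_def algebra_simps flip: scaleR_2)
  ultimately show ?thesis by (simp only: minus) (simp add: k_def)
qed

end

section \<open>Reflections of the dual norm\<close>

context projective_norm
begin

text \<open>\<open>y\<close> is a point of the unit ball farthest from \<open>- u\<close>, so the
  ball lies inside a Euclidean ball whose sphere it touches at \<open>y\<close>. Strict convexity of
  the Euclidean ball makes the normal \<open>a\<close> expose \<open>y\<close>.\<close>

lemma farthest_point_exposed:
  assumes u: "u \<noteq> 0" and y: "N y \<le> 1" and far: "\<And>v. N v \<le> 1 \<Longrightarrow> norm (v + u) \<le> norm (y + u)"
  defines "a \<equiv> y + u"
  shows "a \<bullet> y > 0" and "\<And>v. N v \<le> 1 \<Longrightarrow> a \<bullet> v \<le> a \<bullet> y"
    and "N (v - (2 * ((a \<bullet> v) / (a \<bullet> y))) *\<^sub>R y) = N v"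
proof -
  have "norm a \<ge> norm u" using far[of 0] by (simp add: a_def)
  then have a0: "a \<noteq> 0" using u by auto
  have sq: "a \<bullet> v \<le> a \<bullet> y \<and> (a \<bullet> v = a \<bullet> y \<longrightarrow> v = y)" if v: "N v \<le> 1" for v
  proof -
    have "(norm (v + u))\<^sup>2 \<le> (norm a)\<^sup>2" using far[OF v] by (simp add: a_def)
    then have 1: "(v + u) \<bullet> (v + u) \<le> a \<bullet> a" by (simp add: power2_norm_eq_inner)
    have "(norm (v - y))\<^sup>2 = ((v + u) - a) \<bullet> ((v + u) - a)"
      by (simp add: a_def power2_norm_eq_inner)
    also have "\<dots> = (v + u) \<bullet> (v + u) - 2 * (a \<bullet> (v + u)) + a \<bullet> a"
      by (simp add: inner_diff_left inner_diff_right inner_commute)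
    also have "\<dots> \<le> 2 * (a \<bullet> a) - 2 * (a \<bullet> (v + u))" using 1 by simp
    also have "\<dots> = 2 * (a \<bullet> y - a \<bullet> v)"
      by (simp add: a_def inner_add_left inner_add_right)
    finally have "(norm (v - y))\<^sup>2 \<le> 2 * (a \<bullet> y - a \<bullet> v)" .
    moreover have "(norm (v - y))\<^sup>2 \<ge> 0" by simp
    ultimately show ?thesis by (smt (verit) power2_less_0 zero_eq_power2 right_minus_eq norm_eq_zero)
  qed
  then show le: "\<And>v. N v \<le> 1 \<Longrightarrow> a \<bullet> v \<le> a \<bullet> y" by blast
  have "0 < a \<bullet> (a /\<^sub>R N a)" using a0 pos[OF a0] by simp
  also have "\<dots> \<le> a \<bullet> y" by (rule le) (simp add: normalize[OF a0])
  finally show p: "a \<bullet> y > 0" .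
  define g where "g = a /\<^sub>R (a \<bullet> y)"
  have g_le: "g \<bullet> v \<le> N v" for v
  proof (cases "v = 0")
    case False
    then have "a \<bullet> (v /\<^sub>R N v) \<le> a \<bullet> y" by (intro le) (simp add: normalize)
    then show ?thesis using p pos[OF False] by (simp add: g_def field_simps)
  qed simp
  have gy: "g \<bullet> y = 1" using p by (simp add: g_def)
  interpret exposed_point N y g
  proof
    show "g \<bullet> y = 1" by (rule gy)
    show "g \<bullet> v \<le> N v" for v by (rule g_le)
    show "N y = 1" using g_le[of y] gy y by simp
    show "v = y" if "N v \<le> 1" "g \<bullet> v = 1" for v
      using sq[OF that(1)] that(2) p by (simp add: g_def field_simps)
  qed
  show "N (v - (2 * ((a \<bullet> v) / (a \<bullet> y))) *\<^sub>R y) = N v"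
    using reflection_isometry[of v] by (simp add: g_def field_simps)
qed

text \<open>The points farthest from ever more remote multiples of \<open>- u\<close> have exposing
  functionals whose directions tend to \<open>u\<close>, and their reflections have a limit because
  the ball is compact. The last clause says that \<open>u\<close> attains its maximum on the unit
  ball at \<open>x\<close> divided by \<open>N x\<close>.\<close>

lemma ex_dual_reflection:
  assumes u: "u \<noteq> 0"
  shows "\<exists>x. u \<bullet> x = 1 \<and> (\<forall>v. N (v - (2 * (u \<bullet> v)) *\<^sub>R x) = N v) \<and> (\<forall>v. (u \<bullet> v) * N x \<le> N v)"
proof -
  have "\<exists>y. N y \<le> 1 \<and> (\<forall>v. N v \<le> 1 \<longrightarrow> norm (v + real (Suc n) *\<^sub>R u) \<le> norm (y + real (Suc n) *\<^sub>R u))"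
    for n
  proof -
    have "0 \<in> {v. N v \<le> 1}" by simp
    moreover have "continuous_on {v. N v \<le> 1} (\<lambda>v. norm (v + real (Suc n) *\<^sub>R u))"
      by (intro continuous_intros)
    ultimately show ?thesis using continuous_attains_sup[OF compact_ball] by blast
  qed
  then obtain y where y: "\<And>n. N (y n) \<le> 1"
    and far: "\<And>n v. N v \<le> 1 \<Longrightarrow> norm (v + real (Suc n) *\<^sub>R u) \<le> norm (y n + real (Suc n) *\<^sub>R u)"
    by metis
  \<comment> \<open>Dividing the normal by \<open>real (Suc n)\<close> leaves the reflection
    unchanged, and the rescaled normals tend to \<open>u\<close> since \<open>y n\<close> stays
    bounded.\<close>
  define b where "b n = u + (1 / real (Suc n)) *\<^sub>R y n" for n
  have b: "y n + real (Suc n) *\<^sub>R u = real (Suc n) *\<^sub>R b n" for n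
    by (simp add: b_def scaleR_add_right add.commute del: of_nat_Suc)
  have nz: "real (Suc n) *\<^sub>R u \<noteq> 0" for n using u by simp
  note exposed = farthest_point_exposed[OF nz y far, unfolded b]
  have by0: "b n \<bullet> y n > 0" and b_le: "N v \<le> 1 \<Longrightarrow> b n \<bullet> v \<le> b n \<bullet> y n" for n v
    using exposed(1)[of n] exposed(2)[of v n]
    by (simp_all add: zero_less_mult_iff del: of_nat_Suc)
  have refl: "N (v - (2 * ((b n \<bullet> v) / (b n \<bullet> y n))) *\<^sub>R y n) = N v" for n v
    using exposed(3)[of v n] by (simp del: of_nat_Suc)
  have "\<forall>n. y n \<in> {v. N v \<le> 1}" using y by simp
  then obtain z r where z: "N z \<le> 1" and r: "strict_mono (r :: nat \<Rightarrow> nat)"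
    and lim: "(y \<circ> r) \<longlonglongrightarrow> z"
    using compact_ball unfolding compact_def by blast
  have ylim: "(\<lambda>n. y (r n)) \<longlonglongrightarrow> z" using lim by (simp add: o_def)
  have "(\<lambda>n. 1 / real (Suc (r n))) \<longlonglongrightarrow> 0"
    using LIMSEQ_subseq_LIMSEQ[OF LIMSEQ_Suc[OF lim_1_over_n] r] by (simp add: o_def)
  then have "(\<lambda>n. b (r n)) \<longlonglongrightarrow> u + 0 *\<^sub>R z"
    unfolding b_def by (intro tendsto_intros ylim)
  then have blim: "(\<lambda>n. b (r n)) \<longlonglongrightarrow> u" by simp
  have le: "u \<bullet> v \<le> u \<bullet> z" if v: "N v \<le> 1" for v
    by (rule LIMSEQ_le[OF tendsto_inner[OF blim tendsto_const] tendsto_inner[OF blim ylim]])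
      (use b_le[OF v] in auto)
  have "0 < u \<bullet> (u /\<^sub>R N u)" using u pos[OF u] by simp
  also have "\<dots> \<le> u \<bullet> z" by (rule le) (simp add: normalize[OF u])
  finally have uz: "u \<bullet> z > 0" .
  define x where "x = z /\<^sub>R (u \<bullet> z)"
  have ux: "u \<bullet> x = 1" using uz by (simp add: x_def)
  have "N (v - (2 * (u \<bullet> v)) *\<^sub>R x) = N v" for v
  proof -
    have "(\<lambda>n. v - (2 * ((b (r n) \<bullet> v) / (b (r n) \<bullet> y (r n)))) *\<^sub>R y (r n)) \<longlonglongrightarrow>
        v - (2 * ((u \<bullet> v) / (u \<bullet> z))) *\<^sub>R z"
      using uz by (intro tendsto_intros blim ylim) simp
    then have "(\<lambda>n. N (v - (2 * ((b (r n) \<bullet> v) / (b (r n) \<bullet> y (r n)))) *\<^sub>R y (r n))) \<longlonglongrightarrow>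
        N (v - (2 * ((u \<bullet> v) / (u \<bullet> z))) *\<^sub>R z)"
      using continuous_on_tendsto_compose[OF continuous] by simp
    then have "N (v - (2 * ((u \<bullet> v) / (u \<bullet> z))) *\<^sub>R z) = N v"
      by (simp only: refl LIMSEQ_const_iff)
    then show ?thesis by (simp add: x_def divide_inverse mult.assoc)
  qed
  moreover have "(u \<bullet> v) * N x \<le> N v" for v
  proof (cases "v = 0")
    case False
    then have "u \<bullet> (v /\<^sub>R N v) \<le> u \<bullet> z" by (intro le) (simp add: normalize)
    then have uv: "u \<bullet> v \<le> N v * (u \<bullet> z)" using pos[OF False] by (simp add: field_simps)
    have Nx: "N x * (u \<bullet> z) \<le> 1" using uz z by (simp add: x_def scale field_simps)
    have "(u \<bullet> v) * N x \<le> N v * (u \<bullet> z) * N x" using uv by (intro mult_right_mono) auto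
    also have "\<dots> = N v * (N x * (u \<bullet> z))" by simp
    also have "\<dots> \<le> N v * 1" using Nx by (intro mult_left_mono) auto
    finally show ?thesis by simp
  qed simp
  ultimately show ?thesis using ux by blast
qed

section \<open>The dual norm, its reflections and the return to \<open>N\<close>\<close>

definition dual_norm :: "real^3 \<Rightarrow> real" where
  "dual_norm u = (SUP v\<in>{v. N v \<le> 1}. u \<bullet> v)"

lemma dual_norm_upper: "N v \<le> 1 \<Longrightarrow> u \<bullet> v \<le> dual_norm u"
  unfolding dual_norm_def
proof (rule cSUP_upper)
  have "compact ((\<lambda>v. u \<bullet> v) ` {v. N v \<le> 1})"
    by (intro compact_continuous_image compact_ball continuous_intros)
  then show "bdd_above ((\<lambda>v. u \<bullet> v) ` {v. N v \<le> 1})"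
    by (intro bounded_imp_bdd_above compact_imp_bounded)
qed simp

lemma dual_norm_least: "(\<And>v. N v \<le> 1 \<Longrightarrow> u \<bullet> v \<le> c) \<Longrightarrow> dual_norm u \<le> c"
  unfolding dual_norm_def by (rule cSUP_least) (auto intro: exI[of _ 0])

lemma dual_norm_scale_le: "dual_norm (c *\<^sub>R u) \<le> \<bar>c\<bar> * dual_norm u"
proof (rule dual_norm_least)
  fix v assume v: "N v \<le> 1"
  show "c *\<^sub>R u \<bullet> v \<le> \<bar>c\<bar> * dual_norm u"
  proof (cases "c \<ge> 0")
    case True
    then show ?thesis using dual_norm_upper[OF v, of u] by (simp add: mult_left_mono)
  next
    case False
    then have "(- c) * (u \<bullet> (- v)) \<le> (- c) * dual_norm u"
      using dual_norm_upper[of "- v" u] v by (intro mult_left_mono) auto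
    then show ?thesis using False by simp
  qed
qed

sublocale dual: vector_norm dual_norm
proof
  fix u v :: "real^3" and c :: real
  show "dual_norm (u + v) \<le> dual_norm u + dual_norm v"
    by (rule dual_norm_least) (simp add: inner_add_left add_mono dual_norm_upper)
  show "dual_norm (c *\<^sub>R u) = \<bar>c\<bar> * dual_norm u"
  proof (cases "c = 0")
    case True
    have "dual_norm 0 \<ge> 0" using dual_norm_upper[of 0 0] by simp
    moreover have "dual_norm 0 \<le> 0" by (rule dual_norm_least) simp
    ultimately show ?thesis using True by simp
  next
    case False
    have "dual_norm u \<le> \<bar>inverse c\<bar> * dual_norm (c *\<^sub>R u)"
      using dual_norm_scale_le[of "inverse c" "c *\<^sub>R u"] False by simp
    then have "\<bar>c\<bar> * dual_norm u \<le> dual_norm (c *\<^sub>R u)" using False by (simp add: field_simps)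
    then show ?thesis using dual_norm_scale_le[of c u] by simp
  qed
  assume u: "u \<noteq> 0"
  have "0 < u \<bullet> (u /\<^sub>R N u)" using u pos[OF u] by simp
  also have "\<dots> \<le> dual_norm u" by (rule dual_norm_upper) (simp add: normalize[OF u])
  finally show "dual_norm u > 0" .
qed

text \<open>The adjoint \<open>S\<close> of the reflection is a contraction for the dual norm and an
  involution, hence an isometry. The relation between \<open>N x\<close> and
  \<open>dual_norm u\<close> later carries the inner product back to \<open>N\<close>.\<close>

lemma ex_dual_reflecting:
  assumes "u \<noteq> 0"
  shows "\<exists>x. dual.reflecting u (\<lambda>h. h \<bullet> x) \<and> N x * dual_norm u = 1"
proof -
  obtain x where ux: "u \<bullet> x = 1" and iso: "\<And>v. N (v - (2 * (u \<bullet> v)) *\<^sub>R x) = N v"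
    and le: "\<And>v. (u \<bullet> v) * N x \<le> N v"
    using ex_dual_reflection[OF assms] by blast
  have x0: "x \<noteq> 0" using ux by auto
  then have Nx: "N x > 0" by (rule pos)
  define S where "S h = h - (2 * (h \<bullet> x)) *\<^sub>R u" for h
  have S_le: "dual_norm (S h) \<le> dual_norm h" for h
  proof (rule dual_norm_least)
    fix v assume "N v \<le> 1"
    then have "h \<bullet> (v - (2 * (u \<bullet> v)) *\<^sub>R x) \<le> dual_norm h"
      by (intro dual_norm_upper) (simp add: iso)
    then show "S h \<bullet> v \<le> dual_norm h"
      by (simp add: S_def inner_diff_left inner_diff_right mult_ac)
  qed
  have "S (S h) = h" for h
    using ux by (simp add: S_def inner_diff_left algebra_simps)
  then have "dual_norm (S h) = dual_norm h" for h
    using S_le[of h] S_le[of "S h"] by simp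
  then have "dual.reflecting u (\<lambda>h. h \<bullet> x)"
    using ux by (auto simp: dual.reflecting_def S_def linear_iff inner_add_left)
  moreover have "dual_norm u \<le> 1 / N x"
  proof (rule dual_norm_least)
    fix v assume "N v \<le> 1"
    then have "(u \<bullet> v) * N x \<le> 1" using le[of v] by simp
    then show "u \<bullet> v \<le> 1 / N x" using Nx by (simp add: field_simps)
  qed
  moreover have "1 / N x \<le> dual_norm u"
    using dual_norm_upper[of "x /\<^sub>R N x" u] normalize[OF x0] ux by (simp add: divide_inverse)
  ultimately show ?thesis using Nx by (auto simp: field_simps)
qed

sublocale dual: reflective_norm dual_norm
  by unfold_locales (use ex_dual_reflecting in blast)

text \<open>The vector \<open>A u\<close> represents the functional
  \<open>\<lambda>h. B h u\<close>. For nonzero \<open>u\<close> it is a multiple of the vector from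
  \<open>ex_dual_reflecting\<close>, whence \<open>N (A u) = dual_norm u\<close>. So
  \<open>A\<close> is a linear isomorphism carrying the dual norm to \<open>N\<close>, and
  \<open>B\<close> is transported along its inverse.\<close>

theorem ex_inner_product:
  obtains C where "\<And>v w. C v w = C w v" and "\<And>w. linear (\<lambda>v. C v w)" and "\<And>v. C v v = (N v)\<^sup>2"
proof -
  obtain B where sym: "\<And>x y. B x y = B y x" and lin: "\<And>y. linear (\<lambda>x. B x y)"
    and sq: "\<And>x. B x x = (dual_norm x)\<^sup>2"
    and rep: "\<And>u \<phi> h. dual.reflecting u \<phi> \<Longrightarrow> B h u = (dual_norm u)\<^sup>2 * \<phi> h"
    using dual.ex_inner_product by blast
  have "\<exists>a. (\<forall>h. h \<bullet> a = B h u) \<and> N a = dual_norm u" for u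
  proof (cases "u = 0")
    case True
    have "B h 0 = 0" for h using sym lin linear_0 by metis
    then show ?thesis using True by (intro exI[of _ 0]) simp
  next
    case False
    then obtain x where x: "dual.reflecting u (\<lambda>h. h \<bullet> x)" "N x * dual_norm u = 1"
      using ex_dual_reflecting by blast
    have "N ((dual_norm u)\<^sup>2 *\<^sub>R x) = dual_norm u * (N x * dual_norm u)"
      by (simp add: scale power2_eq_square)
    then show ?thesis using x rep[OF x(1)] by (intro exI[of _ "(dual_norm u)\<^sup>2 *\<^sub>R x"]) simp
  qed
  then obtain A where A: "\<And>h u. h \<bullet> A u = B h u" and NA: "\<And>u. N (A u) = dual_norm u"
    by metis
  have lin': "linear (B x)" for x 
  proof -
    have "(\<lambda>y. B y x) = B x" using sym by auto
    then show ?thesis using lin[of x] by simp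
  qed
  have "linear A"
  proof (rule linearI)
    show "A (u + v) = A u + A v" for u v
      by (subst vector_eq_ldot[symmetric]) (simp add: A inner_add_right linear_add[OF lin'])
    show "A (c *\<^sub>R u) = c *\<^sub>R A u" for c u
      by (subst vector_eq_ldot[symmetric]) (simp add: A linear_scale[OF lin'])
  qed
  moreover have "inj A"
  proof (rule linear_injective_0[THEN iffD2, rule_format, OF \<open>linear A\<close>])
    fix u assume "A u = 0"
    then have "dual_norm u = 0" using NA[of u] by simp
    then show "u = 0" using dual.pos[of u] by fastforce
  qed
  ultimately obtain A' where A': "linear A'" "\<And>v. A (A' v) = v"
    using linear_injective_isomorphism[of A] by blast
  show ?thesis
  proof (rule that[of "\<lambda>v w. B (A' v) (A' w)"])
    show "linear (\<lambda>v. B (A' v) (A' w))" for w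
      using linear_compose[OF A'(1) lin[of "A' w"]] by (simp add: o_def)
    show "B (A' v) (A' v) = (N v)\<^sup>2" for v using NA[of "A' v"] by (simp add: sq A')
  qed (rule sym)
qed

end

section \<open>Three-dimensional slices\<close>

text \<open>Every \<open>x\<close> differs from some multiple of \<open>v\<close> by an element of
  the range, so \<open>x - P x\<close> is the same multiple of \<open>v - P v\<close>: the
  complementary projection has rank one.\<close>

lemma codim_one_projection_rank_one:
  fixes P :: "'a::real_normed_vector \<Rightarrow> 'a"
  assumes P: "bounded_linear P" and idem: "P \<circ> P = P" and "onorm P = 1"
    and codim: "codim_one (range P)"
  obtains e :: 'a and f where "norm e = 1" and "linear f" and "f e = 1"
    and "\<And>x. norm (x - f x *\<^sub>R e) \<le> norm x"
proof -
  have lin: "linear P" using P by (rule bounded_linear.linear)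
  have PP: "P (P x) = P x" for x using idem by (metis comp_apply)
  obtain v where v: "v \<notin> range P" and dec: "\<And>x. \<exists>c. x - c *\<^sub>R v \<in> range P"
    using codim unfolding codim_one_def by blast
  define e0 where "e0 = v - P v"
  have e0: "e0 \<noteq> 0" using v unfolding e0_def by (metis rangeI right_minus_eq)
  define e where "e = e0 /\<^sub>R norm e0"
  have e: "norm e = 1" using e0 by (simp add: e_def)
  have "\<exists>c. x - P x = c *\<^sub>R e" for x
  proof -
    obtain c y where c: "x - c *\<^sub>R v = P y" using dec by blast
    then have "P (x - c *\<^sub>R v) = x - c *\<^sub>R v" using PP by simp
    then have "x - P x = c *\<^sub>R e0"
      by (simp add: e0_def linear_diff[OF lin] linear_scale[OF lin] algebra_simps)
    then have "x - P x = (c * norm e0) *\<^sub>R e" using e0 by (simp add: e_def)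
    then show ?thesis by blast
  qed
  then obtain f where f: "\<And>x. x - P x = f x *\<^sub>R e" by metis
  have inj: "c *\<^sub>R e = d *\<^sub>R e \<Longrightarrow> c = d" for c d using e by auto
  have "linear f"
  proof (rule linearI)
    show "f (x + y) = f x + f y" for x y
    proof (rule inj)
      have "f (x + y) *\<^sub>R e = (x - P x) + (y - P y)"
        by (simp add: f[symmetric] linear_add[OF lin])
      then show "f (x + y) *\<^sub>R e = (f x + f y) *\<^sub>R e" by (simp add: f scaleR_add_left)
    qed
    show "f (c *\<^sub>R x) = c *\<^sub>R f x" for c x
    proof (rule inj)
      have "f (c *\<^sub>R x) *\<^sub>R e = c *\<^sub>R (x - P x)"
        by (simp add: f[symmetric] linear_scale[OF lin] scaleR_diff_right)
      then show "f (c *\<^sub>R x) *\<^sub>R e = (c *\<^sub>R f x) *\<^sub>R e" by (simp add: f)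
    qed
  qed
  moreover have "f e = 1"
  proof (rule inj)
    have "P e = 0" by (simp add: e_def e0_def linear_scale[OF lin] linear_diff[OF lin] PP)
    then show "f e *\<^sub>R e = 1 *\<^sub>R e" using f[of e] by simp
  qed
  moreover have "norm (x - f x *\<^sub>R e) \<le> norm x" for x
    using onorm[OF P, of x] assms(3) by (simp flip: f)
  ultimately show ?thesis using that e by blast
qed

lemma surj_lin_isometry_inv:
  assumes "surj_lin_isometry T"
  shows "linear (inv T)" and "norm (inv T x) = norm x" and "inv T (T x) = x" and "T (inv T x) = x"
proof -
  have lin: "linear T" and surj: "surj T" and iso: "\<And>x. norm (T x) = norm x"
    using assms by (auto simp: surj_lin_isometry_def)
  have "inj T"
  proof (rule injI)
    fix x y assume "T x = T y"
    then have "norm (T (x - y)) = 0" by (simp add: linear_diff[OF lin])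
    then show "x = y" by (simp add: iso)
  qed
  then show l: "inv T (T x) = x" for x by simp
  show r: "T (inv T x) = x" for x using surj by (rule surj_f_inv_f)
  show "norm (inv T x) = norm x" using iso[of "inv T x"] by (simp add: r)
  show "linear (inv T)"
  proof (rule linearI)
    show "inv T (x + y) = inv T x + inv T y" for x y
      by (metis l r linear_add[OF lin])
    show "inv T (c *\<^sub>R x) = c *\<^sub>R inv T x" for c x
      by (metis l r linear_scale[OF lin])
  qed
qed

text \<open>Conjugating the given projection by isometries moves its kernel arbitrarily close to any
  line; restricted to a slice of finite dimension, the conjugates have a limit.\<close>

lemma almost_transitive_ex_projection:
  fixes L :: "'e::euclidean_space \<Rightarrow> 'a::real_normed_vector" and f :: "'a \<Rightarrow> real"
  assumes trans: "almost_transitive TYPE('a)"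
    and e: "norm e = 1" and f: "linear f" "f e = 1" and contr: "\<And>x. norm (x - f x *\<^sub>R e) \<le> norm x"
    and L: "linear L" "inj L" and w: "w \<noteq> 0"
  shows "\<exists>g. g \<bullet> w = 1 \<and> (\<forall>v. norm (L (v - (g \<bullet> v) *\<^sub>R w)) \<le> norm (L v))"
proof -
  have Lw: "L w \<noteq> 0" using L w by (metis linear_injective_0)
  define u where "u = L w /\<^sub>R norm (L w)"
  have "u \<in> sphere 0 1" using Lw by (simp add: u_def)
  then have "u \<in> closure {T e | T. surj_lin_isometry T}"
    using trans e unfolding almost_transitive_def by blast
  then obtain t where t: "\<And>n. t n \<in> {T e | T. surj_lin_isometry T}" and tlim: "t \<longlonglongrightarrow> u"
    unfolding closure_sequential by blast
  then have "\<forall>n. \<exists>T. surj_lin_isometry T \<and> t n = T e" by blast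
  then obtain T where T: "\<And>n. surj_lin_isometry (T n)" and tT: "\<And>n. t n = T n e" by metis
  have f_le: "\<bar>f x\<bar> \<le> 2 * norm x" for x
  proof -
    have "\<bar>f x\<bar> = norm (x - (x - f x *\<^sub>R e))" using e by simp
    also have "\<dots> \<le> norm x + norm (x - f x *\<^sub>R e)" by (rule norm_triangle_ineq4)
    finally show ?thesis using contr[of x] by simp
  qed
  \<comment> \<open>\<open>h n\<close> is the functional of the projection conjugated by
    \<open>T n\<close>, whose kernel is spanned by \<open>t n\<close>.\<close>
  define h where "h n x = f (inv (T n) x)" for n x
  note inv_T = surj_lin_isometry_inv[OF T]
  have linh: "linear (h n)" for n
    using linear_compose[OF inv_T(1)[of n] f(1)] by (simp add: h_def[abs_def] o_def)
  have h_le: "\<bar>h n x\<bar> \<le> 2 * norm x" for n x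
    using f_le[of "inv (T n) x"] by (simp add: h_def inv_T)
  have ht: "h n (t n) = 1" for n by (simp add: h_def tT inv_T f)
  have h_contr: "norm (x - h n x *\<^sub>R t n) \<le> norm x" for n x
  proof -
    have "linear (T n)" using T by (simp add: surj_lin_isometry_def)
    then have "x - h n x *\<^sub>R t n = T n (inv (T n) x - f (inv (T n) x) *\<^sub>R e)"
      by (simp add: linear_diff linear_scale inv_T h_def tT)
    moreover have "norm (T n y) = norm y" for y using T by (simp add: surj_lin_isometry_def)
    ultimately show ?thesis using contr[of "inv (T n) x"] by (simp add: inv_T)
  qed
  \<comment> \<open>The adjoint evaluated at 1 is the vector representing \<open>h n\<close> on the
    slice; these vectors form a bounded sequence in finite dimension.\<close>
  define F where "F n = adjoint (h n \<circ> L) 1" for n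
  have F: "F n \<bullet> v = h n (L v)" for n v
    using adjoint_works[OF linear_compose[OF L(1) linh[of n]], of v 1]
    by (simp add: F_def inner_commute)
  have "bounded_linear L" using L by (simp add: linear_conv_bounded_linear)
  then obtain K where K: "\<And>v. norm (L v) \<le> norm v * K" using bounded_linear.bounded by blast
  have "norm (F n) \<le> 2 * K" for n
  proof (cases "F n = 0")
    case True
    have "0 \<le> norm w * K" using K[of w] norm_ge_zero order_trans by blast
    then show ?thesis using True w by (simp add: zero_le_mult_iff)
  next
    case False
    have "norm (F n) * norm (F n) = h n (L (F n))"
      by (simp flip: F add: power2_norm_eq_inner[symmetric] power2_eq_square)
    also have "\<dots> \<le> 2 * (norm (F n) * K)" using h_le[of n "L (F n)"] K[of "F n"] by linarith
    finally show ?thesis using False by simp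
  qed
  then have "\<forall>n. F n \<in> cball 0 (2 * K)" by simp
  then obtain F' r where r: "strict_mono (r :: nat \<Rightarrow> nat)" and "(F \<circ> r) \<longlonglongrightarrow> F'"
    using compact_cball[of "0::'e" "2 * K"] unfolding compact_def by metis
  then have Flim: "(\<lambda>n. F (r n)) \<longlonglongrightarrow> F'" by (simp add: o_def)
  have tlim': "(\<lambda>n. t (r n)) \<longlonglongrightarrow> u"
    using LIMSEQ_subseq_LIMSEQ[OF tlim r] by (simp add: o_def)
  \<comment> \<open>\<open>h (r n)\<close> is 1 at \<open>t (r n)\<close>, and the uniform bound on
    the functionals transfers this value to \<open>u\<close> in the limit.\<close>
  have bound: "\<bar>F (r n) \<bullet> w / norm (L w) - 1\<bar> \<le> 2 * norm (u - t (r n))" for n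
  proof -
    have "h (r n) (u - t (r n)) = F (r n) \<bullet> w / norm (L w) - 1"
      by (simp add: linear_diff[OF linh] ht u_def linear_scale[OF linh] F divide_inverse)
    then show ?thesis using h_le[of "r n" "u - t (r n)"] by simp
  qed
  have "(\<lambda>n. \<bar>F (r n) \<bullet> w / norm (L w) - 1\<bar>) \<longlonglongrightarrow> \<bar>F' \<bullet> w / norm (L w) - 1\<bar>"
    using Lw by (intro tendsto_intros Flim) simp
  moreover have "(\<lambda>n. 2 * norm (u - t (r n))) \<longlonglongrightarrow> 2 * norm (u - u)"
    by (intro tendsto_intros tlim')
  ultimately have "\<bar>F' \<bullet> w / norm (L w) - 1\<bar> \<le> 2 * norm (u - u)"
    by (rule LIMSEQ_le) (use bound in auto)
  then have Fw: "F' \<bullet> w / norm (L w) = 1" by (simp only: diff_self norm_zero mult_zero_right abs_le_zero_iff right_minus_eq)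
  have lim_contr: "norm (L v - (F' \<bullet> v) *\<^sub>R u) \<le> norm (L v)" for v
  proof (rule LIMSEQ_le_const2)
    show "(\<lambda>n. norm (L v - (F (r n) \<bullet> v) *\<^sub>R t (r n))) \<longlonglongrightarrow> norm (L v - (F' \<bullet> v) *\<^sub>R u)"
      by (intro tendsto_intros Flim tlim')
    show "\<exists>n0. \<forall>n\<ge>n0. norm (L v - (F (r n) \<bullet> v) *\<^sub>R t (r n)) \<le> norm (L v)"
      using h_contr by (simp add: F)
  qed
  define g where "g = F' /\<^sub>R norm (L w)"
  have "g \<bullet> w = 1" using Fw by (simp only: g_def inner_scaleR_left divide_inverse mult.commute)
  moreover have "norm (L (v - (g \<bullet> v) *\<^sub>R w)) \<le> norm (L v)" for v
  proof -
    have "L (v - (g \<bullet> v) *\<^sub>R w) = L v - (F' \<bullet> v) *\<^sub>R u"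
      by (simp add: g_def u_def linear_diff[OF L(1)] linear_scale[OF L(1)] mult.commute)
    then show ?thesis using lim_contr by simp
  qed
  ultimately show ?thesis by blast
qed

section \<open>Passing between the space and its three-dimensional subspaces\<close>

lemma dim_at_least_ex_independent_superset:
  assumes dim: "dim_at_least TYPE('a::real_vector) n"
    and "independent (S::'a set)" "finite S" "card S \<le> n"
  shows "\<exists>S'. S \<subseteq> S' \<and> independent S' \<and> finite S' \<and> card S' = n"
  using assms(2-4)
proof (induction "n - card S" arbitrary: S)
  case 0
  then show ?case by auto
next
  case (Suc k)
  obtain U :: "'a set" where U: "finite U" "card U = n" "independent U"
    using dim by (auto simp: dim_at_least_def)
  \<comment> \<open>By Steinitz exchange, fewer than \<open>n\<close> vectors cannot span the
    \<open>n\<close> independent ones in \<open>U\<close>.\<close>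
  have "\<not> U \<subseteq> span S"
    using independent_span_bound[OF Suc.prems(2) U(3)] U(2) Suc.hyps(2) by auto
  then obtain v where v: "v \<in> U" "v \<notin> span S" by auto
  then have "v \<notin> S" using span_base by blast
  then have "independent (insert v S)" "finite (insert v S)" "card (insert v S) = Suc (card S)"
    using v Suc.prems by (auto simp: independent_insert)
  then show ?case using Suc.hyps(1)[of "insert v S"] Suc.hyps(2) Suc.prems(3)
    by (metis Suc_diff_Suc Suc_inject Suc_leI insert_subset zero_less_Suc zero_less_diff)
qed

text \<open>The prescribed vectors may be dependent, so a maximal independent subset of them is
  completed to three vectors.\<close>

lemma dim_at_least_3_ex_slice:
  fixes x y z :: "'a::real_vector"
  assumes dim: "dim_at_least TYPE('a) 3"
  obtains L :: "real^3 \<Rightarrow> 'a" where "linear L" and "inj L" and "{x, y, z} \<subseteq> range L"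
proof -
  obtain S where S: "S \<subseteq> {x, y, z}" "independent S" "{x, y, z} \<subseteq> span S"
    using maximal_independent_subset[of "{x, y, z}"] by blast
  have fin: "finite S" using S finite_subset by blast
  have "card S \<le> card {x, y, z}" using S by (intro card_mono) auto
  also have "\<dots> \<le> 3" by (simp add: card_insert_if)
  finally obtain U where U: "S \<subseteq> U" "independent U" "finite U" "card U = 3"
    using dim_at_least_ex_independent_superset[OF dim S(2) fin] by blast
  then obtain a b c where abc: "U = {a, b, c}" "a \<noteq> b" "a \<noteq> c" "b \<noteq> c"
    by (auto simp: card_3_iff)
  define L :: "real^3 \<Rightarrow> 'a" where "L v = (v $ 1) *\<^sub>R a + (v $ 2) *\<^sub>R b + (v $ 3) *\<^sub>R c" for v
  have lin: "linear L"
    by (rule linearI) (simp_all add: L_def algebra_simps)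
  have "v = 0" if "L v = 0" for v
  proof -
    define \<alpha> where "\<alpha> t = (if t = a then v $ 1 else if t = b then v $ 2 else v $ 3)" for t
    have "(\<Sum>t\<in>U. \<alpha> t *\<^sub>R t) = 0"
      using that abc by (simp add: \<alpha>_def L_def add.assoc)
    then have "\<forall>t\<in>U. \<alpha> t = 0" using U(2,3) independentD[of U U \<alpha>] by blast
    then have "v $ 1 = 0" "v $ 2 = 0" "v $ 3 = 0" using abc by (auto simp: \<alpha>_def)
    then show ?thesis by (simp add: vec_eq_iff forall_3)
  qed
  then have "inj L" using linear_injective_0[OF lin] by blast
  moreover have "{x, y, z} \<subseteq> range L"
  proof -
    have "L (axis 1 1) = a" "L (axis 2 1) = b" "L (axis 3 1) = c"
      by (simp_all add: L_def axis_def)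
    then have "U \<subseteq> range L" unfolding abc by (metis empty_subsetI insert_subset rangeI)
    then have "span U \<subseteq> range L"
      by (intro span_minimal) (simp_all add: linear_subspace_image[OF lin])
    then show ?thesis using S(3) span_mono[OF U(1)] by blast
  qed
  ultimately show ?thesis using that lin by blast
qed

text \<open>Polarisation defines \<open>ip\<close> from the norm alone, independently of any slice.
  Each linearity identity involves at most three vectors; these lie in a common slice, where
  \<open>ip\<close> coincides with the form \<open>C\<close>.\<close>

lemma hilbertianI_slices:
  assumes dim: "dim_at_least TYPE('a::real_normed_vector) 3"
    and slice: "\<And>L :: real^3 \<Rightarrow> 'a::real_normed_vector. linear L \<Longrightarrow> inj L \<Longrightarrow>
      \<exists>C. (\<forall>v w. C v w = C w v) \<and> (\<forall>w. linear (\<lambda>v. C v w)) \<and> (\<forall>v. C v v = (norm (L v))\<^sup>2)"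
  shows "hilbertian TYPE('a::real_normed_vector)"
proof -
  define ip :: "'a \<Rightarrow> 'a \<Rightarrow> real" where
    "ip x y = ((norm (x + y))\<^sup>2 - (norm (x - y))\<^sup>2) / 4" for x y
  have sym: "ip x y = ip y x" for x y
    by (simp add: ip_def add.commute norm_minus_commute)
  have sq: "ip x x = (norm x)\<^sup>2" for x
    by (simp add: ip_def power_mult_distrib flip: scaleR_2)
  have lin: "ip (x + x') y = ip x y + ip x' y \<and> ip (c *\<^sub>R x) y = c * ip x y" for x x' y c
  proof -
    obtain L :: "real^3 \<Rightarrow> 'a" where L: "linear L" "inj L" and "{x, x', y} \<subseteq> range L"
      using dim_at_least_3_ex_slice[OF dim] by blast
    then obtain p p' q where pq: "x = L p" "x' = L p'" "y = L q" by auto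
    obtain C where C: "\<And>v w. C v w = C w v" "\<And>w. linear (\<lambda>v. C v w)"
        "\<And>v. C v v = (norm (L v))\<^sup>2"
      using slice[OF L] by blast
    have add: "C (v + v') w = C v w + C v' w" and diff: "C (v - v') w = C v w - C v' w"
      and scale: "C (r *\<^sub>R v) w = r * C v w" for v v' w r
      using linear_add[OF C(2)] linear_diff[OF C(2)] linear_scale[OF C(2)] by auto
    have ip: "ip (L v) (L w) = C v w" for v w
    proof -
      have "ip (L v) (L w) = (C (v + w) (v + w) - C (v - w) (v - w)) / 4"
        by (simp add: ip_def C(3) linear_add[OF L(1)] linear_diff[OF L(1)])
      also have "C (v + w) (v + w) = C v v + 2 * C v w + C w w"
        using C(1)[of v "v + w"] C(1)[of w "v + w"] C(1)[of v w] by (simp add: add)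
      also have "C (v - w) (v - w) = C v v - 2 * C v w + C w w"
        using C(1)[of v "v - w"] C(1)[of w "v - w"] C(1)[of v w] by (simp add: diff)
      finally show ?thesis by simp
    qed
    have "x + x' = L (p + p')" "c *\<^sub>R x = L (c *\<^sub>R p)"
      by (simp_all add: pq linear_add[OF L(1)] linear_scale[OF L(1)])
    then show ?thesis by (simp add: ip add scale pq)
  qed
  have "linear (\<lambda>x. ip x y)" for y by (rule linearI) (use lin in auto)
  then show ?thesis unfolding hilbertian_def using sym sq by (intro exI[of _ ip]) auto
qed

theorem theorem2p7:
  fixes P :: "'a::banach \<Rightarrow> 'a"
  assumes "dim_at_least TYPE('a) 3"
    and "bounded_linear P"
    and "P \<circ> P = P"
    and "onorm P = 1"
    and "closed (range P)"
    and "codim_one (range P)"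
    and "almost_transitive TYPE('a)"
  shows "hilbertian TYPE('a)"
proof (rule hilbertianI_slices[OF assms(1)])
  fix L :: "real^3 \<Rightarrow> 'a" assume L: "linear L" "inj L"
  obtain e :: 'a and f where ef: "norm e = 1" "linear f" "f e = 1" "\<And>x. norm (x - f x *\<^sub>R e) \<le> norm x"
    using codim_one_projection_rank_one[OF assms(2-4,6)] by blast
  interpret projective_norm "\<lambda>v. norm (L v)"
  proof
    show "norm (L (x + y)) \<le> norm (L x) + norm (L y)" for x y
      by (simp add: linear_add[OF L(1)] norm_triangle_ineq)
    show "norm (L (c *\<^sub>R x)) = \<bar>c\<bar> * norm (L x)" for c x
      by (simp add: linear_scale[OF L(1)])
    show "norm (L x) > 0" if "x \<noteq> 0" for x
      using L that by (metis linear_injective_0 zero_less_norm_iff)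
    show "continuous_on UNIV (\<lambda>v. norm (L v))"
      using L(1) by (intro continuous_intros linear_continuous_on) (simp add: linear_conv_bounded_linear)
    \<comment> \<open>Almost transitivity and the given projection enter the slice through this
      property.\<close>
    show "\<exists>g. g \<bullet> w = 1 \<and> (\<forall>v. norm (L (v - (g \<bullet> v) *\<^sub>R w)) \<le> norm (L v))" if "w \<noteq> 0" for w
      by (rule almost_transitive_ex_projection[OF assms(7) ef L that])
  qed
  show "\<exists>C. (\<forall>v w. C v w = C w v) \<and> (\<forall>w. linear (\<lambda>v. C v w)) \<and> (\<forall>v. C v v = (norm (L v))\<^sup>2)"
    using ex_inner_product by metis
qed

end
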